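(* Let $\mathbf{F}\in k[z_1,\ldots,z_n]^{l\times m}$ with $l\le m$, and let $d=z_1-f(z_2,\ldots,z_n)$ with $f\in k[z_2,\ldots,z_n]$. Suppose that $d\mid d_l(\mathbf{F})$ and $\mathrm{GCD}(d,d_{l-1}(\mathbf{F}))=1$. Let $h_1,\ldots,h_\gamma$ be all the $(l-1)\times(l-1)$ reduced minors of $\mathbf{F}$. If $\langle d,h_1,\ldots,h_\gamma\rangle=k[z_1,\ldots,z_n]$, then $\mathbf{F}$ admits a matrix factorization with respect to $d$, i.e. there exist $\mathbf{G}_1\in k[z_1,\ldots,z_n]^{l\times l}$ and $\mathbf{F}_1\in k[z_1,\ldots,z_n]^{l\times m}$ such that $\mathbf{F}=\mathbf{G}_1\mathbf{F}_1$ and $\det(\mathbf{G}_1)=d$.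
   Context: Throughout, $k$ is an algebraically closed field, $n\ge 3$, and $k[z_1,\ldots,z_n]$ is the polynomial ring; $k[z_1,\ldots,z_n]^{l\times m}$ is the set of $l\times m$ matrices with entries in this ring. An $r\times r$ minor of a matrix is the determinant of an $r\times r$ submatrix (rows and columns chosen in increasing order). For $\mathbf{F}\in k[z_1,\ldots,z_n]^{l\times m}$ with $l\le m$, $d_l(\mathbf{F})$ and $d_{l-1}(\mathbf{F})$ denote the greatest common divisors (GCD) of all the $l\times l$ minors and of all the $(l-1)\times(l-1)$ minors of $\mathbf{F}$, respectively. If $c_1,\ldots,c_\gamma$, with $\gamma=\binom{l}{l-1}\binom{m}{l-1}$, are all the $(l-1)\times(l-1)$ minors of $\mathbf{F}$ and $c_i=d_{l-1}(\mathbf{F})\,h_i$ for $i=1,\ldots,\gamma$, then $h_1,\ldots,h_\gamma$ are called the $(l-1)\times(l-1)$ reduced minors of $\mathbf{F}$. $\langle\cdots\rangle$ denotes the ideal generated in $k[z_1,\ldots,z_n]$. *)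

theory Defs
  imports
    "HOL-Library.Cardinality"
    "HOL-Library.Poly_Mapping"
    "HOL-Computational_Algebra.Polynomial"
    "Jordan_Normal_Form.Determinant"
    "Jordan_Normal_Form.DL_Submatrix"
begin

text \<open>
  Polynomials over \<open>'k\<close> in the variables indexed by \<open>'n\<close>: finitely supported maps from
  exponent vectors to coefficients, with the convolution product of
  \<^theory>\<open>HOL-Library.Poly_Mapping\<close>. For \<open>'n\<close> finite with \<open>n\<close> elements this whole type is the
  ring \<open>k[z\<^sub>1, \<dots>, z\<^sub>n]\<close>, so divisibility and ideals are those of the ambient type.
\<close>

type_synonym ('n, 'k) mpoly = "('n \<Rightarrow>\<^sub>0 nat) \<Rightarrow>\<^sub>0 'k"

definition Var :: "'n \<Rightarrow> ('n, 'k::comm_ring_1) mpoly" where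
  "Var i = Poly_Mapping.single (Poly_Mapping.single i 1) 1"

definition vars :: "('n, 'k::comm_ring_1) mpoly \<Rightarrow> 'n set" where
  "vars p = (\<Union>e \<in> Poly_Mapping.keys p. Poly_Mapping.keys e)"

text \<open>
  Greatest common divisors in a ring without a chosen normalisation are only determined up to
  units, hence a relation. In particular \<open>0\<close> is the GCD of a family of zeros.
\<close>

definition is_GCD :: "'a::comm_ring_1 \<Rightarrow> 'a set \<Rightarrow> bool" where
  "is_GCD g S \<longleftrightarrow> (\<forall>s\<in>S. g dvd s) \<and> (\<forall>c. (\<forall>s\<in>S. c dvd s) \<longrightarrow> c dvd g)"

definition ideal_generated :: "'a::comm_ring_1 set \<Rightarrow> 'a set" where
  "ideal_generated S = module.span (*) S"

text \<open>
  Rows and columns are numbered from \<open>0\<close>; \<^const>\<open>submatrix\<close> lists the selected ones in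
  increasing order. The minors of size \<open>0\<close> are all \<open>1\<close>.
\<close>

definition minor_indices :: "nat \<Rightarrow> 'a mat \<Rightarrow> (nat set \<times> nat set) set" where
  "minor_indices r A =
     {(I, J). I \<subseteq> {..<dim_row A} \<and> card I = r \<and> J \<subseteq> {..<dim_col A} \<and> card J = r}"

definition minor :: "'a::comm_ring_1 mat \<Rightarrow> nat set \<times> nat set \<Rightarrow> 'a" where
  "minor A = (\<lambda>(I, J). det (submatrix A I J))"

definition minors :: "nat \<Rightarrow> 'a::comm_ring_1 mat \<Rightarrow> 'a set" where
  "minors r A = minor A ` minor_indices r A"

text \<open>
  The family \<open>h\<close> of reduced minors of size \<open>r\<close> relative to the chosen GCD \<open>g\<close> of the
  minors of size \<open>r\<close>; it is indexed by the positions of the minors instead of \<open>1, \<dots>, \<gamma>\<close>.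
\<close>

definition are_reduced_minors ::
    "nat \<Rightarrow> 'a::comm_ring_1 mat \<Rightarrow> 'a \<Rightarrow> (nat set \<times> nat set \<Rightarrow> 'a) \<Rightarrow> bool" where
  "are_reduced_minors r A g h \<longleftrightarrow>
     is_GCD g (minors r A) \<and> (\<forall>s \<in> minor_indices r A. minor A s = g * h s)"

end

theory Submission
  imports Defs
begin

text \<open>
  No completion of unimodular rows is needed. Substituting \<open>z\<^sub>1 \<mapsto> f\<close> is a ring endomorphism
  \<open>\<phi>\<close> with kernel \<open>\<langle>d\<rangle>\<close> and \<open>\<phi> x \<equiv> x\<close> modulo \<open>d\<close>. All maximal minors of \<open>\<phi> F\<close> vanish, so its
  left kernel has rank one, and the signed vectors of the \<open>\<phi> h\<^sub>i\<close> belonging to a fixed choice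
  of columns lie in it. As the \<open>\<phi> h\<^sub>i\<close> generate the unit ideal, some matrix \<open>E\<close> has all rows
  in the left kernel and trace \<open>1\<close>; its \<open>2 \<times> 2\<close> minors vanish. Hence \<open>G\<^sub>1 = I + (d - 1) E\<close> has
  determinant \<open>1 + (d - 1) tr E = d\<close>. Since \<open>E F = d Q\<close> for some \<open>Q\<close> and \<open>E\<^sup>2 = E\<close>, the matrix
  \<open>F\<^sub>1 = F - E F + E Q\<close> satisfies \<open>G\<^sub>1 F\<^sub>1 = F\<close>.
\<close>

section \<open>Determinants of rank-one perturbations\<close>

text \<open>The matrix determinant lemma, freed of division: the extra factor \<open>D\<close> on
  the left avoids the exponent \<open>n - 1\<close>, which would be wrong for
  \<open>n = 0\<close>.\<close>

lemma det_scalar_plus_outer: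
  fixes u v :: "nat \<Rightarrow> 'a::idom"
  shows "det (mat n n (\<lambda>(i,j). (if i = j then D else 0) + u i * v j)) * D
    = D ^ n * (D + (\<Sum>i<n. v i * u i))"
proof -
  define U where "U = mat n 1 (\<lambda>(i,j). u i)"
  define V where "V = mat 1 n (\<lambda>(i,j). v j)"
  define DD where "DD = mat 1 1 (\<lambda>(i,j::nat). D)"
  have c: "U \<in> carrier_mat n 1" "V \<in> carrier_mat 1 n" "DD \<in> carrier_mat 1 1"
    by (auto simp: U_def V_def DD_def)
  have one: "det X = X $$ (0,0)" if "X \<in> carrier_mat 1 1" for X :: "'a mat"
    using that by (subst det_upper_triangular[of X 1]) (auto simp: diag_mat_def)
  \<comment> \<open>Both sides are \<open>D ^ n\<close> times the determinant of the bordered matrix \<open>M\<close>, which is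
    triangularised once by \<open>P\<close> and once by \<open>Q\<close>.\<close>
  define M where "M = four_block_mat (1\<^sub>m n) (-U) V DD"
  have cM: "M \<in> carrier_mat (n+1) (n+1)"
    unfolding M_def by (rule four_block_carrier_mat) (use c in auto)
  define P where "P = four_block_mat (1\<^sub>m n) U (0\<^sub>m 1 n) (1\<^sub>m 1)"
  define Q where "Q = four_block_mat (D \<cdot>\<^sub>m 1\<^sub>m n) (0\<^sub>m n 1) (-V) (1\<^sub>m 1)"
  have cP: "P \<in> carrier_mat (n+1) (n+1)" and cQ: "Q \<in> carrier_mat (n+1) (n+1)"
    unfolding P_def Q_def by (rule four_block_carrier_mat; use c in auto)+
  have "det P = 1"
    unfolding P_def by (subst det_four_block_mat_lower_left_zero) (use c in auto)
  moreover have "det Q = D ^ n"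
    unfolding Q_def by (subst det_four_block_mat_upper_right_zero) (use c in auto)
  moreover have "M * P = four_block_mat (1\<^sub>m n) (0\<^sub>m n 1) V (V * U + DD)"
    unfolding M_def P_def
    by (subst mult_four_block_mat[of _ n n _ 1 _ 1 _ _ n _ 1]) (use c in \<open>auto intro!: arg_cong2[where f = "\<lambda>x y. four_block_mat x y _ _"]\<close>)
  moreover have "det (four_block_mat (1\<^sub>m n) (0\<^sub>m n 1) V (V * U + DD)) = D + (\<Sum>i<n. v i * u i)"
  proof -
    have cVU: "V * U + DD \<in> carrier_mat 1 1" using c by auto
    have "(V * U + DD) $$ (0,0) = D + (\<Sum>i<n. v i * u i)"
      by (simp add: U_def V_def DD_def scalar_prod_def atLeast0LessThan)
    then show ?thesis
      using det_four_block_mat_upper_right_zero[OF one_carrier_mat refl c(2) cVU] one[OF cVU] by simp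
  qed
  moreover have "M * Q = four_block_mat (D \<cdot>\<^sub>m 1\<^sub>m n + U * V) (-U) (0\<^sub>m 1 n) DD"
  proof -
    have "- U * - V = U * V" using c by (simp add: uminus_mult_right_mat)
    moreover have "V * (D \<cdot>\<^sub>m 1\<^sub>m n) + DD * - V = 0\<^sub>m 1 n"
      by (rule eq_matI)
         (auto simp: V_def DD_def scalar_prod_def if_distrib[of "\<lambda>x. _ * x"] cong: if_cong)
    ultimately show ?thesis
      unfolding M_def Q_def
      by (subst mult_four_block_mat[of _ n n _ 1 _ 1 _ _ n _ 1]) (use c in auto)
  qed
  moreover have "det (four_block_mat (D \<cdot>\<^sub>m 1\<^sub>m n + U * V) (-U) (0\<^sub>m 1 n) DD)
    = det (D \<cdot>\<^sub>m 1\<^sub>m n + U * V) * D"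
    by (subst det_four_block_mat_lower_left_zero) (use c one[OF c(3)] in \<open>auto simp: DD_def\<close>)
  moreover have "D \<cdot>\<^sub>m 1\<^sub>m n + U * V = mat n n (\<lambda>(i,j). (if i = j then D else 0) + u i * v j)"
    by (rule eq_matI) (auto simp: U_def V_def scalar_prod_def)
  moreover have "det (M * P) = det M * det P" "det (M * Q) = det M * det Q"
    using det_mult[OF cM cP] det_mult[OF cM cQ] by auto
  ultimately show ?thesis by (simp add: mult.commute)
qed

text \<open>All 2 by 2 minors of \<open>E\<close> vanish, so with the pivot
  \<open>D = E $$ (q,q)\<close> the matrix \<open>D\<close> times \<open>E\<close> is the product of
  column \<open>q\<close> and row \<open>q\<close>. Thus \<open>det_scalar_plus_outer\<close>
  applies after scaling by \<open>D\<close>, and the powers of \<open>D\<close> cancel.\<close>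

lemma det_one_plus_rank_one:
  fixes E :: "'a::idom mat"
  assumes E: "E \<in> carrier_mat n n"
    and rank: "\<And>p q r s. p < n \<Longrightarrow> q < n \<Longrightarrow> r < n \<Longrightarrow> s < n \<Longrightarrow>
      E $$ (p,q) * E $$ (r,s) = E $$ (p,s) * E $$ (r,q)"
    and q: "q < n" "E $$ (q,q) \<noteq> 0"
  shows "det (1\<^sub>m n + c \<cdot>\<^sub>m E) = 1 + c * (\<Sum>i<n. E $$ (i,i))"
proof -
  define D where "D = E $$ (q,q)"
  have D: "D \<noteq> 0" using q by (simp add: D_def)
  have "D \<cdot>\<^sub>m (1\<^sub>m n + c \<cdot>\<^sub>m E)
    = mat n n (\<lambda>(i,j). (if i = j then D else 0) + (c * E $$ (i,q)) * E $$ (q,j))"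
  proof (rule eq_matI, goal_cases)
    case (1 i j)
    then have "E $$ (i,q) * E $$ (q,j) = D * E $$ (i,j)"
      using rank[of i q q j] q by (simp add: D_def mult.commute)
    then show ?case using 1 E by (simp add: algebra_simps)
  qed (use E in auto)
  then have "det (D \<cdot>\<^sub>m (1\<^sub>m n + c \<cdot>\<^sub>m E)) * D = D ^ n * (D + (\<Sum>i<n. E $$ (q,i) * (c * E $$ (i,q))))"
    using det_scalar_plus_outer[of n D "\<lambda>i. c * E $$ (i,q)" "\<lambda>j. E $$ (q,j)"] by simp
  moreover have "E $$ (q,i) * (c * E $$ (i,q)) = D * (c * E $$ (i,i))" if "i < n" for i
    using rank[of q i i q] that q by (simp add: D_def mult.left_commute)
  then have "(\<Sum>i<n. E $$ (q,i) * (c * E $$ (i,q))) = D * (c * (\<Sum>i<n. E $$ (i,i)))"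
    unfolding sum_distrib_left by (intro sum.cong) auto
  ultimately have "D ^ n * D * det (1\<^sub>m n + c \<cdot>\<^sub>m E) = D ^ n * D * (1 + c * (\<Sum>i<n. E $$ (i,i)))"
    using E by (simp add: algebra_simps)
  then show ?thesis using D by simp
qed

section \<open>Cofactors and vectors in the left kernel\<close>

lemma cofactor_cong_col:
  assumes "A \<in> carrier_mat n n" "B \<in> carrier_mat n n" "k < n"
    and "\<And>i j. i < n \<Longrightarrow> j < n \<Longrightarrow> j \<noteq> k \<Longrightarrow> A $$ (i,j) = B $$ (i,j)"
  shows "cofactor A p k = cofactor B p k"
proof -
  have "mat_delete A p k = mat_delete B p k"
    unfolding mat_delete_def by (rule eq_matI) (use assms in \<open>auto intro!: assms(4)\<close>)
  then show ?thesis by (simp add: cofactor_def)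
qed

text \<open>Let \<open>B\<close> be \<open>A\<close> with column \<open>k\<close> replaced by the
  unit vector at \<open>p\<close>. Then \<open>v\<close> times \<open>B\<close> is
  \<open>v p\<close> times the unit row at \<open>k\<close>. Multiplying by the adjugate of
  \<open>B\<close> gives the claim, since \<open>det B\<close> is the cofactor at \<open>p\<close>
  and the cofactors along column \<open>k\<close> do not see that column.\<close>

lemma cofactor_left_kernel:
  fixes A :: "'a::comm_ring_1 mat"
  assumes A: "A \<in> carrier_mat n n" and k: "k < n" and p: "p < n" and q: "q < n"
    and ker: "\<And>j. j < n \<Longrightarrow> j \<noteq> k \<Longrightarrow> (\<Sum>i<n. v i * A $$ (i,j)) = 0"
  shows "v q * cofactor A p k = v p * cofactor A q k"
proof -
  define B where "B = replace_col A (unit_vec n p) k"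
  have B: "B \<in> carrier_mat n n" using A by (auto simp: B_def replace_col_def)
  have Bij: "B $$ (i,j) = (if j = k then (if i = p then 1 else 0) else A $$ (i,j))"
    if "i < n" "j < n" for i j using that A p by (simp add: B_def replace_col_def)
  have cof: "cofactor B i k = cofactor A i k" for i
    by (rule cofactor_cong_col[OF B A k]) (simp add: Bij)
  have "det B = cofactor B p k"
    using laplace_expansion_column[OF B k] p k
    by (simp add: Bij if_distrib[of "\<lambda>x. x * _"] cong: if_cong)
  moreover have "v q * det B = v p * cofactor B q k"
  proof -
    have adj: "(\<Sum>j<n. B $$ (i,j) * cofactor B q j) = (if i = q then det B else 0)" if "i < n" for i
      using arg_cong[OF adj_mat(2)[OF B], of "\<lambda>X. X $$ (i,q)"] that q B
      by (simp add: adj_mat_def scalar_prod_def atLeast0LessThan)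
    have "v q * det B = (\<Sum>i<n. v i * (\<Sum>j<n. B $$ (i,j) * cofactor B q j))"
      using q by (simp add: adj if_distrib[of "\<lambda>x. _ * x"] cong: if_cong)
    also have "\<dots> = (\<Sum>j<n. (\<Sum>i<n. v i * B $$ (i,j)) * cofactor B q j)"
      by (simp add: sum_distrib_left sum_distrib_right mult.assoc) (rule sum.swap)
    also have "\<dots> = (\<Sum>j<n. if j = k then v p * cofactor B q k else 0)"
    proof (rule sum.cong[OF refl], goal_cases)
      case (1 j)
      then show ?case using ker[of j] p
        by (simp add: Bij if_distrib[of "\<lambda>x. _ * x"] cong: if_cong)
    qed
    also have "\<dots> = v p * cofactor B q k" using k by simp
    finally show ?thesis .
  qed
  ultimately show ?thesis by (simp add: cof)
qed

section \<open>Minors and determinants of selected columns\<close>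

lemma pick_lessThan: "i < n \<Longrightarrow> pick {..<n} i = i"
proof -
  assume "i < n"
  moreover from this have "{a \<in> {..<n}. a < i} = {..<i}" by auto
  ultimately show ?thesis using pick_card_in_set[of i "{..<n}"] by simp
qed

lemma pick_lessThan_minus:
  assumes "p < n" "i < n - 1"
  shows "pick ({..<n} - {p}) i = (if i < p then i else Suc i)"
proof (cases "i < p")
  case True
  then have "{a \<in> {..<n} - {p}. a < i} = {..<i}" using assms by auto
  then show ?thesis using pick_card_in_set[of i "{..<n} - {p}"] assms True by auto
next
  case False
  then have "{a \<in> {..<n} - {p}. a < Suc i} = {..<Suc i} - {p}" using assms by auto
  then show ?thesis using pick_card_in_set[of "Suc i" "{..<n} - {p}"] assms False by auto
qed

text \<open>A repeated column makes the determinant vanish. Otherwise the chosen columns are those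
  of a maximal minor up to order, which only affects the sign.\<close>

lemma det_select_cols_eq_0:
  fixes F :: "'a::comm_ring_1 mat"
  assumes F: "F \<in> carrier_mat l m"
    and minors: "\<And>s. s \<in> minor_indices l F \<Longrightarrow> minor F s = 0"
    and g: "\<And>k. k < l \<Longrightarrow> g k < m"
  shows "det (mat l l (\<lambda>(i,k). F $$ (i, g k))) = 0"
proof (cases "inj_on g {..<l}")
  case False
  then obtain i j where "i < l" "j < l" "i \<noteq> j" "g i = g j" by (auto simp: inj_on_def)
  then show ?thesis
    by (intro det_identical_columns[of _ l i j]) (auto intro!: eq_vecI)
next
  case True
  define S where "S = g ` {..<l}"
  have S: "S \<subseteq> {..<m}" "card S = l" "finite S"
    using g True by (auto simp: S_def card_image)
  have Sm: "{j. j < m \<and> j \<in> S} = S" using S by auto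
  \<comment> \<open>\<open>\<pi> k\<close> is the rank of \<open>g k\<close> in \<open>S\<close>,
    hence the position of that column in the submatrix; beyond \<open>l\<close> it is the identity,
    as \<open>permutes\<close> demands.\<close>
  define \<pi> where "\<pi> k = (if k < l then card {a \<in> S. a < g k} else k)" for k
  have pick: "pick S (\<pi> k) = g k" if "k < l" for k
    using that by (simp add: \<pi>_def S_def pick_card_in_set)
  have lt: "\<pi> k < l" if "k < l" for k
  proof -
    have "{a \<in> S. a < g k} \<subset> S" using that by (auto simp: S_def)
    then show ?thesis using psubset_card_mono[OF S(3)] S(2) that by (auto simp: \<pi>_def)
  qed
  have "inj_on \<pi> {0..<l}"
    by (rule inj_onI) (metis True atLeast0LessThan inj_onD lessThan_iff pick)
  moreover have "\<pi> ` {0..<l} \<subseteq> {0..<l}" using lt by auto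
  ultimately have "bij_betw \<pi> {0..<l} {0..<l}"
    by (simp add: bij_betw_def endo_inj_surj)
  then have perm: "\<pi> permutes {0..<l}"
    by (rule bij_imp_permutes) (simp add: \<pi>_def)
  define B where "B = submatrix F {..<l} S"
  have B: "B \<in> carrier_mat l l"
    using F S Sm by (auto simp: B_def dim_submatrix)
  have detB: "det B = 0"
    using minors[of "({..<l}, S)"] F S by (auto simp: minor_def minor_indices_def B_def)
  have Bij: "B $$ (i,k) = F $$ (i, pick S k)" if "i < l" "k < l" for i k
    using that F S Sm by (simp add: B_def submatrix_index pick_lessThan)
  \<comment> \<open>Transposing turns the permutation of columns into one of rows.\<close>
  have "mat l l (\<lambda>(i,k). F $$ (i, g k)) = (mat l l (\<lambda>(i,j). B\<^sup>T $$ (\<pi> i, j)))\<^sup>T"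
    by (rule eq_matI) (use B in \<open>auto simp: Bij lt pick\<close>)
  also have "det \<dots> = det (mat l l (\<lambda>(i,j). B\<^sup>T $$ (\<pi> i, j)))"
    by (rule det_transpose) auto
  also have "\<dots> = signof \<pi> * det B\<^sup>T"
    by (rule det_permute_rows) (use B perm in auto)
  also have "\<dots> = 0" using det_transpose[OF B] detB by simp
  finally show ?thesis .
qed

lemma minor_map_mat:
  assumes "comm_ring_hom \<phi>"
  shows "minor (map_mat \<phi> F) s = \<phi> (minor F s)"
proof -
  interpret comm_ring_hom \<phi> by fact
  obtain I J where s: "s = (I, J)" by fastforce
  have "submatrix (map_mat \<phi> F) I J = map_mat \<phi> (submatrix F I J)"
    unfolding submatrix_def by (rule eq_matI) (auto simp: pick_le)
  then show ?thesis by (simp add: minor_def s)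
qed

text \<open>Turns minors of size \<open>l - 1\<close> into cofactors. The last column of
  \<open>A\<close> is left free, because the cofactors along it delete it.\<close>

lemma cofactor_select_cols:
  fixes K :: "'a::comm_ring_1 mat"
  assumes K: "K \<in> carrier_mat l m" and p: "p < l" and J: "J \<subseteq> {..<m}" "card J = l - 1"
    and A: "A \<in> carrier_mat l l"
      "\<And>i j. i < l \<Longrightarrow> j < l - 1 \<Longrightarrow> A $$ (i,j) = K $$ (i, pick J j)"
  shows "cofactor A p (l - 1) = (-1) ^ (p + (l - 1)) * minor K ({..<l} - {p}, J)"
proof -
  have "{j. j < m \<and> j \<in> J} = J" "{i. i < l \<and> i \<in> {..<l} - {p}} = {..<l} - {p}"
    using J by auto
  moreover have "card ({..<l} - {p}) = l - 1" using p by simp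
  ultimately have "mat_delete A p (l - 1) = submatrix K ({..<l} - {p}) J"
    unfolding mat_delete_def submatrix_def
    by (intro eq_matI) (use K J A p in \<open>auto simp: pick_lessThan_minus\<close>)
  then show ?thesis by (simp add: cofactor_def minor_def)
qed

section \<open>The left kernel of a rectangular matrix\<close>

text \<open>The sum is the Laplace expansion along the last column of the determinant formed by the
  columns \<open>J\<close> followed by column \<open>j\<close>. It vanishes by
  \<open>det_select_cols_eq_0\<close>, which also covers \<open>j\<close> in
  \<open>J\<close>.\<close>

lemma cofactors_in_left_kernel:
  fixes K :: "'a::comm_ring_1 mat"
  assumes K: "K \<in> carrier_mat l m" and l: "1 \<le> l" and j: "j < m"
    and minors: "\<And>s. s \<in> minor_indices l K \<Longrightarrow> minor K s = 0"
    and J: "J \<subseteq> {..<m}" "card J = l - 1"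
    and A: "A \<in> carrier_mat l l"
      "\<And>i j. i < l \<Longrightarrow> j < l - 1 \<Longrightarrow> A $$ (i,j) = K $$ (i, pick J j)"
  shows "(\<Sum>i<l. cofactor A i (l - 1) * K $$ (i,j)) = 0"
proof -
  define g where "g k = (if k < l - 1 then pick J k else j)" for k
  define B where "B = mat l l (\<lambda>(i,k). K $$ (i, g k))"
  have B: "B \<in> carrier_mat l l" by (simp add: B_def)
  have "g k < m" if "k < l" for k
    using pick_in_set_le[of k J] J j by (auto simp: g_def)
  then have "det B = 0"
    unfolding B_def using det_select_cols_eq_0[OF K] minors by blast
  moreover have "cofactor A i (l - 1) = cofactor B i (l - 1)" for i
    by (rule cofactor_cong_col[OF A(1) B]) (use A l in \<open>auto simp: B_def g_def\<close>)
  ultimately show ?thesis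
    using laplace_expansion_column[OF B, of "l - 1"] l by (simp add: B_def g_def mult.commute)
qed

lemma card_eq_minus_1E:
  assumes "I \<subseteq> {..<l}" "card I = l - 1" "1 \<le> l"
  obtains p where "p < l" "I = {..<l} - {p}"
proof -
  have "card ({..<l} - I) = 1"
    using assms by (simp add: card_Diff_subset finite_subset)
  then obtain p where "{..<l} - I = {p}" by (auto simp: card_1_singleton_iff)
  then show thesis using that[of p] assms(1) by blast
qed

text \<open>The nonzero minor yields a cofactor vector \<open>c\<close> with \<open>c p\<close>
  nonzero. By \<open>cofactor_left_kernel\<close> both \<open>v\<close> and \<open>w\<close> are
  proportional to \<open>c\<close>, hence to each other. Cancelling \<open>c p\<close> twice uses
  \<open>no_zd\<close>, a hypothesis because the ring is only a \<open>comm_ring_1\<close>.\<close>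

lemma left_kernel_rank_one:
  fixes K :: "'a::comm_ring_1 mat"
  assumes K: "K \<in> carrier_mat l m" and l: "1 \<le> l"
    and no_zd: "\<And>x y :: 'a. x * y = 0 \<Longrightarrow> x = 0 \<or> y = 0"
    and s: "s \<in> minor_indices (l - 1) K" "minor K s \<noteq> 0"
    and v: "\<And>j. j < m \<Longrightarrow> (\<Sum>i<l. v i * K $$ (i,j)) = 0"
    and w: "\<And>j. j < m \<Longrightarrow> (\<Sum>i<l. w i * K $$ (i,j)) = 0"
    and qr: "q < l" "r < l"
  shows "v q * w r = v r * w q"
proof -
  obtain I J where IJ: "s = (I, J)" "I \<subseteq> {..<l}" "card I = l - 1" "J \<subseteq> {..<m}" "card J = l - 1"
    using s(1) K by (auto simp: minor_indices_def)
  obtain p where p: "p < l" "I = {..<l} - {p}"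
    using card_eq_minus_1E IJ l by metis
  define A where "A = mat l l (\<lambda>(i,j). K $$ (i, pick J j))"
  have A: "A \<in> carrier_mat l l" by (simp add: A_def)
  define c where "c i = cofactor A i (l - 1)" for i
  have "c p = (-1) ^ (p + (l - 1)) * minor K s"
    unfolding c_def using cofactor_select_cols[OF K p(1) IJ(4,5) A] IJ(1) p(2) by (simp add: A_def)
  then have "minor K s = (-1) ^ (p + (l - 1)) * c p"
    by (simp flip: mult.assoc power_mult_distrib)
  then have cp: "c p \<noteq> 0" using s(2) by auto
  have c: "u i * c p = u p * c i"
    if "\<And>j. j < m \<Longrightarrow> (\<Sum>i<l. u i * K $$ (i,j)) = 0" "i < l" for u i
    unfolding c_def
  proof (rule cofactor_left_kernel[OF A _ p(1) that(2)])
    fix j assume "j < l" "j \<noteq> l - 1"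
    then have "j < card J" using IJ(5) by simp
    then have "pick J j < m" using pick_in_set_le[of j J] IJ(4) by auto
    then show "(\<Sum>i<l. u i * A $$ (i,j)) = 0" using that(1) \<open>j < l\<close> by (simp add: A_def)
  qed (use l in auto)
  have "c p * (c p * (v q * w r - v r * w q)) = (v q * c p) * (w r * c p) - (v r * c p) * (w q * c p)"
    by (simp add: algebra_simps)
  also have "\<dots> = 0"
    by (simp only: c[OF v qr(1)] c[OF v qr(2)] c[OF w qr(1)] c[OF w qr(2)]) (simp add: algebra_simps)
  finally have "c p * (c p * (v q * w r - v r * w q)) = 0" .
  then show ?thesis using no_zd cp by (metis eq_iff_diff_eq_0)
qed

section \<open>Factorization from an endomorphism with kernel generated by \<open>d\<close>\<close>

text \<open>\<open>\<phi>\<close> abstracts the substitution. The injective \<open>\<psi>\<close>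
  into an integral domain supplies the absence of zero divisors and a place where
  \<open>det_one_plus_rank_one\<close> applies.\<close>

lemma matrix_factorization_of_retraction:
  fixes F :: "'a::comm_ring_1 mat" and \<phi> :: "'a \<Rightarrow> 'a" and \<psi> :: "'a \<Rightarrow> 'b::idom"
  assumes \<phi>: "comm_ring_hom \<phi>" and \<phi>_d: "\<phi> d = 0" and \<phi>_cong: "\<And>x. d dvd x - \<phi> x"
    and \<psi>: "comm_ring_hom \<psi>" and \<psi>_inj: "\<And>x. \<psi> x = 0 \<Longrightarrow> x = 0"
    and l: "1 \<le> l" and F: "F \<in> carrier_mat l m"
    and minors: "\<And>s. s \<in> minor_indices l F \<Longrightarrow> d dvd minor F s"
    and red: "\<And>s. s \<in> minor_indices (l - 1) F \<Longrightarrow> minor F s = g * h s"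
    and g: "\<phi> g \<noteq> 0"
    and unit: "1 \<in> module.span (*) (insert d (h ` minor_indices (l - 1) F))"
  shows "\<exists>G1 F1. G1 \<in> carrier_mat l l \<and> F1 \<in> carrier_mat l m \<and> F = G1 * F1 \<and> det G1 = d"
proof -
  interpret \<phi>: comm_ring_hom \<phi> by fact
  interpret \<psi>: comm_ring_hom \<psi> by fact
  have module: "Modules.module ((*) :: 'a \<Rightarrow> 'a \<Rightarrow> 'a)"
    by unfold_locales (simp_all add: algebra_simps)
  have no_zd: "x = 0 \<or> y = 0" if "x * y = 0" for x y :: 'a
  proof -
    have "\<psi> x * \<psi> y = 0" using that by (metis \<psi>.hom_mult \<psi>.hom_zero)
    then show ?thesis using \<psi>_inj by auto
  qed
  have nontriv: "(1::'a) \<noteq> 0" using \<psi>.hom_one \<psi>.hom_zero by (metis zero_neq_one)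
  define K where "K = map_mat \<phi> F"
  have K: "K \<in> carrier_mat l m" using F by (simp add: K_def)
  have Kij: "K $$ (i,j) = \<phi> (F $$ (i,j))" if "i < l" "j < m" for i j
    using that F by (simp add: K_def)
  have idx: "minor_indices r K = minor_indices r F" for r
    by (simp add: minor_indices_def K_def)
  have minor_K: "minor K s = \<phi> (minor F s)" for s
    unfolding K_def by (rule minor_map_mat[OF \<phi>])
  have minors_K: "minor K s = 0" if "s \<in> minor_indices l K" for s
    using minors[of s] that by (auto simp: idx minor_K \<phi>.hom_mult \<phi>_d elim!: dvdE)
  define V where "V v \<longleftrightarrow> (\<forall>j<m. (\<Sum>i<l. v i * K $$ (i,j)) = 0)" for v :: "nat \<Rightarrow> 'a"
  \<comment> \<open>The cofactor vector of the columns \<open>J\<close> of \<open>K\<close> with the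
    common factor \<open>\<phi> g\<close> removed; \<open>V\<close> is membership in the left kernel
    of \<open>K\<close>.\<close>
  define w where "w J i = (-1) ^ (i + (l - 1)) * \<phi> (h ({..<l} - {i}, J))" for J i
  have V_w: "V (w J)" if J: "J \<subseteq> {..<m}" "card J = l - 1" for J
    unfolding V_def
  proof (intro allI impI)
    fix j assume j: "j < m"
    define A where "A = mat l l (\<lambda>(i,j). K $$ (i, pick J j))"
    have A: "A \<in> carrier_mat l l" by (simp add: A_def)
    have "cofactor A i (l - 1) = \<phi> g * w J i" if "i < l" for i
    proof -
      have "({..<l} - {i}, J) \<in> minor_indices (l - 1) F"
        using that J F by (auto simp: minor_indices_def)
      then show ?thesis
        using cofactor_select_cols[OF K that J A] red
        by (simp add: A_def minor_K w_def \<phi>.hom_mult algebra_simps)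
    qed
    then have "\<phi> g * (\<Sum>i<l. w J i * K $$ (i,j)) = (\<Sum>i<l. cofactor A i (l - 1) * K $$ (i,j))"
      by (simp add: sum_distrib_left mult.assoc)
    also have "\<dots> = 0"
      by (rule cofactors_in_left_kernel[OF K l j minors_K J A]) (auto simp: A_def)
    finally show "(\<Sum>i<l. w J i * K $$ (i,j)) = 0" using no_zd g by blast
  qed
  \<comment> \<open>Otherwise \<open>\<phi>\<close> would kill all generators of the unit ideal and
    hence \<open>1\<close>. This provides the nonzero minor for
    \<open>left_kernel_rank_one\<close>.\<close>
  have "\<exists>s\<in>minor_indices (l - 1) K. \<phi> (h s) \<noteq> 0"
  proof (rule ccontr)
    assume "\<not> ?thesis"
    then have zero: "\<phi> (h s) = 0" if "s \<in> minor_indices (l - 1) F" for s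
      using that by (auto simp: idx)
    have "\<phi> 1 = 0"
      by (rule module.span_induct_alt[OF module unit])
         (auto simp: \<phi>.hom_add \<phi>.hom_mult \<phi>_d zero)
    then show False using nontriv by simp
  qed
  then obtain s where s: "s \<in> minor_indices (l - 1) K" "\<phi> (h s) \<noteq> 0" ..
  have minor_s: "minor K s \<noteq> 0"
    using s red[of s] no_zd[of "\<phi> g" "\<phi> (h s)"] g by (auto simp: minor_K idx \<phi>.hom_mult)
  \<comment> \<open>Induction over the span: every ideal element \<open>x\<close> is matched by a
    matrix with rows in the left kernel and trace \<open>\<phi> x\<close>. The case
    \<open>x = 1\<close> is the one wanted.\<close>
  have "\<exists>E \<in> carrier_mat l l. (\<forall>p<l. V (\<lambda>q. E $$ (p,q))) \<and> (\<Sum>p<l. E $$ (p,p)) = \<phi> 1"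
  proof (rule module.span_induct_alt[OF module unit], goal_cases)
    case 1
    show ?case by (rule bexI[of _ "0\<^sub>m l l"]) (auto simp: V_def)
  next
    case (2 c x y)
    then obtain E where E: "E \<in> carrier_mat l l" "\<And>p. p < l \<Longrightarrow> V (\<lambda>q. E $$ (p,q))"
      "(\<Sum>p<l. E $$ (p,p)) = \<phi> y" by auto
    show ?case
    proof (cases "x = d")
      case True
      then show ?thesis using E by (intro bexI[of _ E]) (auto simp: \<phi>.hom_add \<phi>.hom_mult \<phi>_d)
    next
      case False
      then obtain I J where x: "x = h (I, J)" and "I \<subseteq> {..<l}" "card I = l - 1"
        and J: "J \<subseteq> {..<m}" "card J = l - 1"
        using 2 F by (auto simp: minor_indices_def)
      then obtain p where p: "p < l" "I = {..<l} - {p}"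
        using card_eq_minus_1E l by metis
      \<comment> \<open>Adding \<open>e\<close> times \<open>w J\<close> to row \<open>p\<close>
        keeps the rows in the kernel. The sign in \<open>e\<close> cancels the one in
        \<open>w J p\<close>, so the trace grows by \<open>\<phi> (c * x)\<close>.\<close>
      define e where "e = (-1) ^ (p + (l - 1)) * \<phi> c"
      define E' where "E' = mat l l (\<lambda>(i,j). E $$ (i,j) + (if i = p then e * w J j else 0))"
      have "e * w J p = ((-1) * (-1)) ^ (p + (l - 1)) * (\<phi> c * \<phi> x)"
        unfolding e_def w_def power_mult_distrib by (simp only: x p(2) ac_simps)
      then have "(\<Sum>i<l. E' $$ (i,i)) = \<phi> (c * x + y)"
        using p(1) E(3) by (simp add: E'_def sum.distrib \<phi>.hom_add \<phi>.hom_mult add.commute)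
      moreover have "V (\<lambda>q. E' $$ (i,q))" if i: "i < l" for i
        unfolding V_def
      proof (intro allI impI)
        fix j assume j: "j < m"
        have "(\<Sum>q<l. E' $$ (i,q) * K $$ (q,j)) = (\<Sum>q<l. E $$ (i,q) * K $$ (q,j))
          + (if i = p then e else 0) * (\<Sum>q<l. w J q * K $$ (q,j))"
          unfolding sum_distrib_left sum.distrib[symmetric]
          by (rule sum.cong) (use i in \<open>auto simp: E'_def algebra_simps\<close>)
        then show "(\<Sum>q<l. E' $$ (i,q) * K $$ (q,j)) = 0"
          using E(2)[OF i] V_w[OF J] j by (simp add: V_def)
      qed
      ultimately show ?thesis by (intro bexI[of _ E']) (auto simp: E'_def)
    qed
  qed
  then obtain E where E: "E \<in> carrier_mat l l" "\<And>p. p < l \<Longrightarrow> V (\<lambda>q. E $$ (p,q))"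
    and trace: "(\<Sum>p<l. E $$ (p,p)) = 1" by auto
  have rank: "E $$ (p,q) * E $$ (r,s) = E $$ (p,s) * E $$ (r,q)"
    if "p < l" "q < l" "r < l" "s < l" for p q r s
    using left_kernel_rank_one[OF K l no_zd _ minor_s, of "\<lambda>q. E $$ (p,q)" "\<lambda>q. E $$ (r,q)" q s]
      E(2) that s(1) by (auto simp: V_def)
  \<comment> \<open>Exchanging column indices by \<open>rank\<close> turns \<open>E * E\<close> into
    the trace of \<open>E\<close> times \<open>E\<close>.\<close>
  have "E * E = E"
  proof (rule eq_matI, goal_cases)
    case (1 i j)
    then have "(E * E) $$ (i,j) = (\<Sum>k<l. E $$ (i,k) * E $$ (k,j))"
      using E by (simp add: scalar_prod_def atLeast0LessThan)
    also have "\<dots> = (\<Sum>k<l. E $$ (i,j) * E $$ (k,k))"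
      by (rule sum.cong) (use rank 1 E in auto)
    also have "\<dots> = E $$ (i,j)" using trace by (simp flip: sum_distrib_left)
    finally show ?case .
  qed (use E in auto)
  have "\<exists>Q. E * F = d \<cdot>\<^sub>m Q \<and> Q \<in> carrier_mat l m"
  proof -
    \<comment> \<open>As \<open>E * K\<close> is zero, \<open>E * F\<close> equals
      \<open>E * (F - K)\<close>, and \<open>d\<close> divides the entries of
      \<open>F - K\<close>.\<close>
    have "d dvd (E * F) $$ (i,j)" if ij: "i < l" "j < m" for i j
    proof -
      have "(E * F) $$ (i,j) = (\<Sum>k<l. E $$ (i,k) * F $$ (k,j)) - (\<Sum>k<l. E $$ (i,k) * K $$ (k,j))"
        using E F ij by (simp add: V_def scalar_prod_def atLeast0LessThan)
      also have "\<dots> = (\<Sum>k<l. E $$ (i,k) * (F $$ (k,j) - \<phi> (F $$ (k,j))))"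
        using ij by (simp add: Kij right_diff_distrib sum_subtractf)
      also have "d dvd \<dots>" by (intro dvd_sum dvd_mult \<phi>_cong)
      finally show ?thesis .
    qed
    then have "(E * F) $$ (i,j) = d * (SOME q. (E * F) $$ (i,j) = d * q)" if "i < l" "j < m" for i j
      using that by (intro someI_ex[of "\<lambda>q. (E * F) $$ (i,j) = d * q"]) (meson dvdE)
    then have "E * F = d \<cdot>\<^sub>m mat l m (\<lambda>(i,j). SOME q. (E * F) $$ (i,j) = d * q)"
      by (intro eq_matI) (use E F in \<open>simp_all del: index_mult_mat(1)\<close>)
    then show ?thesis by (intro exI conjI) auto
  qed
  then obtain Q where Q: "E * F = d \<cdot>\<^sub>m Q" "Q \<in> carrier_mat l m" by blast
  \<comment> \<open>\<open>E\<close> is a projector: \<open>G1\<close> multiplies its image by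
    \<open>d\<close> and fixes its kernel. Correspondingly, \<open>F1\<close> keeps the part
    \<open>F - E * F\<close> and replaces \<open>E * F\<close> by its quotient by \<open>d\<close>,
    namely \<open>E * Q\<close>.\<close>
  define G1 where "G1 = 1\<^sub>m l + (d - 1) \<cdot>\<^sub>m E"
  define F1 where "F1 = F - E * F + E * Q"
  have G1: "G1 \<in> carrier_mat l l" and F1: "F1 \<in> carrier_mat l m"
    using E F Q by (auto simp: G1_def F1_def)
  have EE: "E * (E * X) = E * X" if "X \<in> carrier_mat l m" for X
    using \<open>E * E = E\<close> E that by (simp flip: assoc_mult_mat[OF E(1) E(1) that])
  have "E * F1 = E * Q"
  proof -
    have c: "E * F \<in> carrier_mat l m" "E * Q \<in> carrier_mat l m" using E F Q by auto
    have "E * F1 = E * (F - E * F) + E * (E * Q)"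
      unfolding F1_def by (rule mult_add_distrib_mat[OF E(1) minus_carrier_mat[OF c(1)] c(2)])
    also have "E * (F - E * F) = E * F - E * (E * F)"
      by (rule mult_minus_distrib_mat[OF E(1) F c(1)])
    finally show ?thesis using c by (simp add: EE[OF F] EE[OF Q(2)])
  qed
  have EdQ: "d \<cdot>\<^sub>m (E * Q) = E * F"
    using EE[OF F] Q E mult_smult_distrib[OF E(1) Q(2), of d] by simp
  have "G1 * F1 = F1 + (d - 1) \<cdot>\<^sub>m (E * F1)"
    unfolding G1_def using E F1 by (simp add: add_mult_distrib_mat[of _ l l _ _ m] mult_smult_assoc_mat[of _ l l _ m])
  also have "\<dots> = F1 + (d - 1) \<cdot>\<^sub>m (E * Q)"
    by (simp only: \<open>E * F1 = E * Q\<close>)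
  also have "\<dots> = F"
  proof (rule eq_matI, goal_cases)
    case (1 i j)
    have "d * (E * Q) $$ (i,j) = (E * F) $$ (i,j)"
      using arg_cong[OF EdQ, of "\<lambda>X. X $$ (i,j)"] 1 E F Q(2) by (simp del: index_mult_mat(1))
    then show ?case
      using 1 E F Q(2) by (simp add: F1_def algebra_simps del: index_mult_mat(1))
  qed (use E F Q F1 in auto)
  finally have "F = G1 * F1" ..
  moreover have "det G1 = d"
  proof -
    \<comment> \<open>A matrix of trace \<open>1\<close> has a nonzero diagonal entry, the pivot for
      \<open>det_one_plus_rank_one\<close>.\<close>
    obtain q where q: "q < l" "E $$ (q,q) \<noteq> 0"
    proof (rule ccontr)
      assume "\<not> thesis"
      then have "(\<Sum>p<l. E $$ (p,p)) = 0" using that by (intro sum.neutral) blast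
      then show False using trace nontriv by simp
    qed
    have "map_mat \<psi> G1 = 1\<^sub>m l + \<psi> (d - 1) \<cdot>\<^sub>m map_mat \<psi> E"
      by (rule eq_matI) (use E in \<open>auto simp: G1_def \<psi>.hom_add \<psi>.hom_mult\<close>)
    moreover have "det (1\<^sub>m l + \<psi> (d - 1) \<cdot>\<^sub>m map_mat \<psi> E)
      = 1 + \<psi> (d - 1) * (\<Sum>i<l. map_mat \<psi> E $$ (i,i))"
      by (rule det_one_plus_rank_one[OF _ _ q(1)])
         (use E q \<psi>_inj in \<open>auto simp: rank simp flip: \<psi>.hom_mult\<close>)
    moreover have "(\<Sum>i<l. map_mat \<psi> E $$ (i,i)) = \<psi> (\<Sum>i<l. E $$ (i,i))"
      using E by (simp add: \<psi>.hom_sum)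
    ultimately have "\<psi> (det G1) = \<psi> d"
      by (simp add: trace \<psi>.hom_minus flip: \<psi>.hom_det)
    then have "\<psi> (det G1 - d) = 0" by (simp add: \<psi>.hom_minus)
    then show ?thesis using \<psi>_inj by fastforce
  qed
  ultimately show ?thesis using G1 F1 by blast
qed

section \<open>Homomorphisms out of a monoid algebra\<close>

lemma poly_mapping_single_add_induct [case_names zero single add]:
  assumes "P 0" "\<And>k c. P (Poly_Mapping.single k c)" "\<And>p q. P p \<Longrightarrow> P q \<Longrightarrow> P (p + q)"
  shows "P p"
proof (induction p rule: update_induct)
  case const
  show ?case by fact
next
  case (update p k c)
  \<comment> \<open>The key \<open>k\<close> is absent from \<open>p\<close>, so setting its
    coefficient amounts to adding a monomial.\<close>
  have "Poly_Mapping.update k c p = Poly_Mapping.single k c + p"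
    using update(1)
    by (intro poly_mapping_eqI)
       (auto simp: lookup_update lookup_add lookup_single when_def in_keys_iff)
  then show ?case using assms(2,3) update(3) by metis
qed

text \<open>The map given by the universal property of the monoid algebra: \<open>\<iota>\<close>
  acts on coefficients, \<open>M\<close> on exponents.\<close>

definition monoid_algebra_lift ::
    "('k \<Rightarrow> 'c) \<Rightarrow> ('e \<Rightarrow> 'c) \<Rightarrow> ('e \<Rightarrow>\<^sub>0 'k::zero) \<Rightarrow> 'c::comm_ring_1" where
  "monoid_algebra_lift \<iota> M p = (\<Sum>e\<in>Poly_Mapping.keys p. \<iota> (Poly_Mapping.lookup p e) * M e)"

locale monoid_algebra_hom = \<iota>: comm_ring_hom \<iota>
  for \<iota> :: "'k::comm_ring_1 \<Rightarrow> 'c::comm_ring_1" +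
  fixes M :: "'e::comm_monoid_add \<Rightarrow> 'c"
  assumes M_0: "M 0 = 1" and M_add: "M (a + b) = M a * M b"
begin

text \<open>Lets the sums for \<open>p\<close>, \<open>q\<close> and \<open>p + q\<close> run over
  one common index set.\<close>

lemma lift_superset:
  assumes "finite S" "Poly_Mapping.keys p \<subseteq> S"
  shows "monoid_algebra_lift \<iota> M p = (\<Sum>e\<in>S. \<iota> (Poly_Mapping.lookup p e) * M e)"
  unfolding monoid_algebra_lift_def
  by (rule sum.mono_neutral_left) (use assms in \<open>auto simp: in_keys_iff\<close>)

lemma lift_single: "monoid_algebra_lift \<iota> M (Poly_Mapping.single e c) = \<iota> c * M e"
  by (subst lift_superset[of "{e}"]) auto

lemma lift_add:
  "monoid_algebra_lift \<iota> M (p + q) = monoid_algebra_lift \<iota> M p + monoid_algebra_lift \<iota> M q"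
proof -
  let ?S = "Poly_Mapping.keys p \<union> Poly_Mapping.keys q"
  have "finite ?S" "Poly_Mapping.keys (p + q) \<subseteq> ?S" using keys_add[of p q] by auto
  then show ?thesis
    by (simp add: lift_superset[of ?S] lookup_add \<iota>.hom_add distrib_right sum.distrib)
qed

text \<open>Both sides are biadditive, so monomials suffice.\<close>

lemma lift_mult:
  "monoid_algebra_lift \<iota> M (p * q) = monoid_algebra_lift \<iota> M p * monoid_algebra_lift \<iota> M q"
proof (induction p rule: poly_mapping_single_add_induct)
  case (single k c)
  show ?case
  proof (induction q rule: poly_mapping_single_add_induct)
    case (single k' c')
    show ?case by (simp add: mult_single lift_single M_add \<iota>.hom_mult mult_ac)
  qed (auto simp: lift_add distrib_left monoid_algebra_lift_def[of _ _ 0])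
qed (auto simp: lift_add distrib_right monoid_algebra_lift_def[of _ _ 0])

lemma lift_hom: "comm_ring_hom (monoid_algebra_lift \<iota> M)"
proof
  show "monoid_algebra_lift \<iota> M 1 = 1"
    using lift_single[of 0 1] by (simp add: M_0)
qed (auto simp: lift_add lift_mult monoid_algebra_lift_def[of _ _ 0])

end

section \<open>Embedding and substitution for polynomials\<close>

lemma comm_ring_hom_single_0:
  "comm_ring_hom (Poly_Mapping.single 0 :: 'k::comm_ring_1 \<Rightarrow> 'e::comm_monoid_add \<Rightarrow>\<^sub>0 'k)"
  by unfold_locales (auto simp: single_add mult_single)

text \<open>The library proves the absence of zero divisors only for linearly ordered variables.\<close>

lemma ex_embedding_mpoly_idom:
  "\<exists>\<psi> :: ('n::finite, 'k::idom) mpoly \<Rightarrow> (nat, 'k) mpoly.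
     comm_ring_hom \<psi> \<and> (\<forall>p. \<psi> p = 0 \<longrightarrow> p = 0)"
proof -
  obtain g :: "'n \<Rightarrow> nat" where g: "inj g"
    using finite_imp_inj_to_nat_seg[of "UNIV :: 'n set"] by auto
  \<comment> \<open>Renames the variables of an exponent vector along \<open>g\<close>.\<close>
  define G :: "('n \<Rightarrow>\<^sub>0 nat) \<Rightarrow> (nat \<Rightarrow>\<^sub>0 nat)"
    where "G e = (\<Sum>i\<in>UNIV. Poly_Mapping.single (g i) (Poly_Mapping.lookup e i))" for e
  have "Poly_Mapping.lookup (G e) (g j) = Poly_Mapping.lookup e j" for e j
    by (simp add: G_def lookup_sum lookup_single when_def inj_eq[OF g])
  then have inj_G: "G e = G e' \<longleftrightarrow> e = e'" for e e'
    by (metis poly_mapping_eqI)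
  define M :: "('n \<Rightarrow>\<^sub>0 nat) \<Rightarrow> (nat, 'k) mpoly" where "M e = Poly_Mapping.single (G e) 1" for e
  interpret comm_ring_hom "Poly_Mapping.single 0 :: 'k \<Rightarrow> (nat, 'k) mpoly"
    by (rule comm_ring_hom_single_0)
  interpret monoid_algebra_hom "Poly_Mapping.single 0 :: 'k \<Rightarrow> (nat, 'k) mpoly" M
    by unfold_locales
       (simp_all add: M_def G_def lookup_add single_add sum.distrib mult_single)
  define \<psi> where "\<psi> = monoid_algebra_lift (Poly_Mapping.single 0) M"
  \<comment> \<open>Since \<open>G\<close> is injective, the coefficients of \<open>p\<close> can be
    read off from \<open>\<psi> p\<close>.\<close>
  have "Poly_Mapping.lookup (\<psi> p) (G e) = Poly_Mapping.lookup p e" for p e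
    by (induction p rule: poly_mapping_single_add_induct)
       (auto simp: \<psi>_def lift_add lift_single lookup_add M_def mult_single lookup_single inj_G
         monoid_algebra_lift_def[of _ _ 0])
  then have "p = 0" if "\<psi> p = 0" for p
    using that by (metis lookup_zero poly_mapping_eqI)
  then show ?thesis using lift_hom unfolding \<psi>_def by blast
qed

text \<open>The map replaces \<open>Var z\<close> by \<open>f\<close>; it fixes \<open>f\<close>, in
  which \<open>z\<close> does not occur. The congruence is additive, and on a monomial the
  difference is \<open>Var z ^ n - f ^ n\<close> times a factor free of \<open>z\<close>.\<close>

lemma ex_substitution_hom:
  fixes f :: "('n, 'k::comm_ring_1) mpoly"
  assumes f: "vars f \<subseteq> - {z}"
  shows "\<exists>\<phi> :: ('n, 'k) mpoly \<Rightarrow> ('n, 'k) mpoly.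
    comm_ring_hom \<phi> \<and> \<phi> (Var z - f) = 0 \<and> (\<forall>p. Var z - f dvd p - \<phi> p)"
proof -
  \<comment> \<open>The image of the monomial \<open>e\<close>: its power of \<open>z\<close>
    becomes a power of \<open>f\<close>, and the update erases \<open>z\<close> from the
    exponent.\<close>
  define M :: "('n \<Rightarrow>\<^sub>0 nat) \<Rightarrow> ('n, 'k) mpoly" where
    "M e = f ^ Poly_Mapping.lookup e z * Poly_Mapping.single (Poly_Mapping.update z 0 e) 1" for e
  have upd: "Poly_Mapping.update z 0 (a + b) = Poly_Mapping.update z 0 a + Poly_Mapping.update z 0 b"
    for a b :: "'n \<Rightarrow>\<^sub>0 nat"
    by (rule poly_mapping_eqI) (simp add: lookup_update lookup_add)
  have upd_id: "Poly_Mapping.update z 0 e = e" if "Poly_Mapping.lookup e z = 0"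
    for e :: "'n \<Rightarrow>\<^sub>0 nat"
    by (rule poly_mapping_eqI) (use that in \<open>auto simp: lookup_update\<close>)
  have upd_z: "Poly_Mapping.update z 0 (Poly_Mapping.single z 1) = (0 :: 'n \<Rightarrow>\<^sub>0 nat)"
    by (rule poly_mapping_eqI) (simp add: lookup_update lookup_single when_def)
  interpret single: comm_ring_hom "Poly_Mapping.single 0 :: 'k \<Rightarrow> ('n, 'k) mpoly"
    by (rule comm_ring_hom_single_0)
  have M_add: "M (a + b) = M a * M b" for a b
  proof -
    have "Poly_Mapping.single (Poly_Mapping.update z 0 (a + b)) (1::'k) =
      Poly_Mapping.single (Poly_Mapping.update z 0 a) 1 * Poly_Mapping.single (Poly_Mapping.update z 0 b) 1"
      by (simp add: upd mult_single)
    then show ?thesis by (simp add: M_def lookup_add power_add ac_simps)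
  qed
  interpret monoid_algebra_hom "Poly_Mapping.single 0 :: 'k \<Rightarrow> ('n, 'k) mpoly" M
    by unfold_locales (simp_all only: M_add, simp add: M_def upd_id)
  define \<phi> where "\<phi> = monoid_algebra_lift (Poly_Mapping.single 0) M"
  interpret \<phi>: comm_ring_hom \<phi> unfolding \<phi>_def by (rule lift_hom)
  have "\<phi> (Var z) = f"
    by (simp add: \<phi>_def Var_def lift_single) (simp add: M_def upd_z[unfolded One_nat_def])
  moreover have "\<phi> f = f"
  proof -
    have "Poly_Mapping.single 0 (Poly_Mapping.lookup f e) * M e
      = Poly_Mapping.single e (Poly_Mapping.lookup f e)" if "e \<in> Poly_Mapping.keys f" for e
    proof -
      have "Poly_Mapping.lookup e z = 0"
        using f that by (auto simp: vars_def in_keys_iff)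
      then show ?thesis by (simp add: M_def upd_id mult_single)
    qed
    then have "\<phi> f = (\<Sum>e\<in>Poly_Mapping.keys f. Poly_Mapping.single e (Poly_Mapping.lookup f e))"
      by (simp add: \<phi>_def monoid_algebra_lift_def)
    also have "\<dots> = f"
      by (rule poly_mapping_eqI) (simp add: lookup_sum lookup_single when_def in_keys_iff)
    finally show ?thesis .
  qed
  moreover have "Var z - f dvd p - \<phi> p" for p
  proof (induction p rule: poly_mapping_single_add_induct)
    case (single e c)
    define n where "n = Poly_Mapping.lookup e z"
    define r :: "('n, 'k) mpoly" where "r = Poly_Mapping.single (Poly_Mapping.update z 0 e) c"
    have "Var z ^ k = Poly_Mapping.single (Poly_Mapping.single z k) (1::'k)" for k
      by (induction k) (simp_all add: Var_def mult_single flip: single_add)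
    moreover have "Poly_Mapping.single z n + Poly_Mapping.update z 0 e = e"
      by (rule poly_mapping_eqI) (simp add: n_def lookup_update lookup_add lookup_single when_def)
    ultimately have "Poly_Mapping.single e c = Var z ^ n * r"
      by (simp add: r_def mult_single)
    moreover have "\<phi> (Poly_Mapping.single e c) = f ^ n * r"
      by (simp add: \<phi>_def lift_single M_def r_def n_def mult_single
        mult.left_commute[of "Poly_Mapping.single 0 c"])
    ultimately have "Poly_Mapping.single e c - \<phi> (Poly_Mapping.single e c) = (Var z ^ n - f ^ n) * r"
      by (simp only: left_diff_distrib)
    then show ?case by (simp add: power_diff_sumr2)
  next
    case (add p q)
    then show ?case
      using dvd_add[OF add] by (simp add: \<phi>.hom_add algebra_simps)
  qed simp
  ultimately show ?thesis
    using \<phi>.comm_ring_hom_axioms by (intro exI[of _ \<phi>]) (simp add: \<phi>.hom_minus)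
qed

section \<open>The factorization over the polynomial ring\<close>

theorem theorem3p3:
  fixes F :: "('n::finite, 'k::alg_closed_field) mpoly mat"
    and l m :: nat
    and z1 :: 'n
    and f d dl dl1 :: "('n, 'k) mpoly"
    and h :: "nat set \<times> nat set \<Rightarrow> ('n, 'k) mpoly"
  assumes "CARD('n) \<ge> 3"
    and "1 \<le> l" and "l \<le> m"
    and "F \<in> carrier_mat l m"
    and "vars f \<subseteq> - {z1}"
    and "d = Var z1 - f"
    and "is_GCD dl (minors l F)"
    and "is_GCD dl1 (minors (l - 1) F)"
    and "d dvd dl"
    and "is_GCD 1 {d, dl1}"
    and "are_reduced_minors (l - 1) F dl1 h"
    and "ideal_generated (insert d (h ` minor_indices (l - 1) F)) = UNIV"
  shows "\<exists>G1 F1. G1 \<in> carrier_mat l l \<and> F1 \<in> carrier_mat l m \<and> F = G1 * F1 \<and> det G1 = d"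
proof -
  obtain \<phi> :: "('n, 'k) mpoly \<Rightarrow> ('n, 'k) mpoly" where \<phi>: "comm_ring_hom \<phi>" "\<phi> d = 0"
    and \<phi>_cong: "\<And>p. d dvd p - \<phi> p"
    using ex_substitution_hom[OF assms(5)] assms(6) by auto
  obtain \<psi> :: "('n, 'k) mpoly \<Rightarrow> (nat, 'k) mpoly" where \<psi>: "comm_ring_hom \<psi>"
    and \<psi>_inj: "\<And>p. \<psi> p = 0 \<Longrightarrow> p = 0"
    using ex_embedding_mpoly_idom by blast
  interpret \<phi>: comm_ring_hom \<phi> by fact
  \<comment> \<open>If \<open>\<phi> dl1\<close> vanished, \<open>d\<close> would divide
    \<open>dl1\<close>, and coprimality would make \<open>d\<close> a unit. That is impossible
    because \<open>\<phi> d = 0\<close>.\<close>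
  have "\<phi> dl1 \<noteq> 0"
  proof
    assume "\<phi> dl1 = 0"
    then have "d dvd dl1" using \<phi>_cong[of dl1] by simp
    then have "d dvd 1" using assms(10) by (auto simp: is_GCD_def)
    then obtain e where "1 = d * e" ..
    then have "\<phi> 1 = \<phi> d * \<phi> e" by (simp only: flip: \<phi>.hom_mult)
    then have "\<phi> 1 = 0" by (simp only: \<phi>(2) mult_zero_left)
    then show False by simp
  qed
  moreover have "d dvd minor F s" if "s \<in> minor_indices l F" for s
    using assms(7,9) that by (auto simp: is_GCD_def minors_def intro: dvd_trans)
  moreover have "minor F s = dl1 * h s" if "s \<in> minor_indices (l - 1) F" for s
    using assms(11) that by (simp add: are_reduced_minors_def)
  moreover have "1 \<in> module.span (*) (insert d (h ` minor_indices (l - 1) F))"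
    using assms(12) by (simp add: ideal_generated_def)
  ultimately show ?thesis
    using matrix_factorization_of_retraction[OF \<phi> \<phi>_cong \<psi> \<psi>_inj assms(2,4)] by blast
qed

end
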